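(* Let $X$ be a topological space. (1) If every finite power $X^k$ ($k\in\mathbb{N}$) of $X$ is almost Menger, then $X$ is almost Scheepers. (2) If every finite power $X^k$ ($k\in\mathbb{N}$) of $X$ is weakly Menger, then $X$ is weakly Scheepers.
   Context: For a topological space $X$, in each item below the condition is required for every sequence $(\mathcal{U}_n)_{n\in\mathbb{N}}$ of open covers of $X$. $X$ is almost Menger if there are finite $\mathcal{V}_n\subseteq\mathcal{U}_n$ such that $\{\overline{V}: V\in\bigcup_{n}\mathcal{V}_n\}$ covers $X$. $X$ is weakly Menger if there are finite $\mathcal{V}_n\subseteq\mathcal{U}_n$ such that $\bigcup\left(\bigcup_{n}\mathcal{V}_n\right)$ is dense in $X$. $X$ is almost Scheepers if there are finite $\mathcal{V}_n\subseteq\mathcal{U}_n$ such that every finite set $F\subseteq X$ is contained in $\overline{\bigcup\mathcal{V}_n}$ for some $n$. $X$ is weakly Scheepers if there are finite $\mathcal{V}_n\subseteq\mathcal{U}_n$ such that for every finite collection $\mathcal{F}$ of nonempty open subsets of $X$ there is an $n$ with $U\cap\left(\bigcup\mathcal{V}_n\right)\neq\emptyset$ for all $U\in\mathcal{F}$. *)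

theory Defs
  imports "HOL-Analysis.Analysis"
begin

definition open_cover :: "'a topology \<Rightarrow> 'a set set \<Rightarrow> bool" where
  "open_cover X \<U> \<longleftrightarrow> (\<forall>U\<in>\<U>. openin X U) \<and> \<Union>\<U> = topspace X"

definition almost_Menger :: "'a topology \<Rightarrow> bool" where
  "almost_Menger X \<longleftrightarrow>
    (\<forall>\<U> :: nat \<Rightarrow> 'a set set. (\<forall>n. open_cover X (\<U> n)) \<longrightarrow>
      (\<exists>\<V>. (\<forall>n. finite (\<V> n) \<and> \<V> n \<subseteq> \<U> n) \<and>
           topspace X \<subseteq> (\<Union>V\<in>(\<Union>n. \<V> n). X closure_of V)))"

definition weakly_Menger :: "'a topology \<Rightarrow> bool" where
  "weakly_Menger X \<longleftrightarrow>
    (\<forall>\<U> :: nat \<Rightarrow> 'a set set. (\<forall>n. open_cover X (\<U> n)) \<longrightarrow>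
      (\<exists>\<V>. (\<forall>n. finite (\<V> n) \<and> \<V> n \<subseteq> \<U> n) \<and>
           X closure_of (\<Union>(\<Union>n. \<V> n)) = topspace X))"

definition almost_Scheepers :: "'a topology \<Rightarrow> bool" where
  "almost_Scheepers X \<longleftrightarrow>
    (\<forall>\<U> :: nat \<Rightarrow> 'a set set. (\<forall>n. open_cover X (\<U> n)) \<longrightarrow>
      (\<exists>\<V>. (\<forall>n. finite (\<V> n) \<and> \<V> n \<subseteq> \<U> n) \<and>
           (\<forall>F. finite F \<and> F \<subseteq> topspace X \<longrightarrow> (\<exists>n. F \<subseteq> X closure_of (\<Union>(\<V> n))))))"

definition weakly_Scheepers :: "'a topology \<Rightarrow> bool" where
  "weakly_Scheepers X \<longleftrightarrow>
    (\<forall>\<U> :: nat \<Rightarrow> 'a set set. (\<forall>n. open_cover X (\<U> n)) \<longrightarrow>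
      (\<exists>\<V>. (\<forall>n. finite (\<V> n) \<and> \<V> n \<subseteq> \<U> n) \<and>
           (\<forall>\<F>. finite \<F> \<and> (\<forall>U\<in>\<F>. openin X U \<and> U \<noteq> {}) \<longrightarrow>
                (\<exists>n. \<forall>U\<in>\<F>. U \<inter> \<Union>(\<V> n) \<noteq> {}))))"

text \<open>The points of the power are the functions on \<open>{..<k}\<close> with values in \<open>topspace X\<close>,
  extended by \<open>undefined\<close> outside \<open>{..<k}\<close>.\<close>

definition finite_power :: "'a topology \<Rightarrow> nat \<Rightarrow> (nat \<Rightarrow> 'a) topology" where
  "finite_power X k = product_topology (\<lambda>_. X) {..<k}"

end

theory Submission
  imports Defs
begin

text \<open>Index the given covers of \<open>X\<close> by pairs \<open>(k, m)\<close>. For fixed \<open>k\<close>, the boxes with sides in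
  the \<open>(k, m)\<close>-th cover form a sequence of open covers of the power of exponent \<open>Suc k\<close>, to which
  the Menger hypothesis applies; the sides of the finitely many boxes chosen at stage \<open>m\<close> are the
  selection from the \<open>(k, m)\<close>-th cover. A finite set of points (or of nonempty open sets) is
  encoded as one point (or one nonempty open box) of a power, and a single chosen box
  handles all of its coordinates at once.\<close>

text \<open>The index set is finite, so a box with open sides is open in the product. A point is
  covered by choosing a member of \<open>\<U>\<close> around each of its coordinates.\<close>

lemma open_cover_boxes:
  assumes "open_cover X \<U>"
  shows "open_cover (finite_power X k) (PiE {..<k} ` ({..<k} \<rightarrow>\<^sub>E \<U>))"
proof -
  have "openin (finite_power X k) W" if W: "W \<in> PiE {..<k} ` ({..<k} \<rightarrow>\<^sub>E \<U>)" for W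
  proof -
    obtain g where "g \<in> {..<k} \<rightarrow>\<^sub>E \<U>" "W = PiE {..<k} g"
      using W by blast
    moreover from this have "openin X (g i)" if "i < k" for i
      using assms that PiE_mem[of g] unfolding open_cover_def by blast
    ultimately show ?thesis
      by (simp add: finite_power_def openin_PiE_gen)
  qed
  moreover have "\<exists>g \<in> {..<k} \<rightarrow>\<^sub>E \<U>. x \<in> PiE {..<k} g" if "x \<in> topspace (finite_power X k)" for x
  proof -
    have x: "x \<in> {..<k} \<rightarrow>\<^sub>E topspace X"
      using that by (simp add: finite_power_def)
    have "\<exists>U\<in>\<U>. x i \<in> U" if "i \<in> {..<k}" for i
      using PiE_mem[OF x that] assms unfolding open_cover_def by blast
    then obtain g where "\<And>i. i \<in> {..<k} \<Longrightarrow> g i \<in> \<U> \<and> x i \<in> g i"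
      by metis
    with x show ?thesis
      by (intro bexI[of _ "restrict g {..<k}"]) (auto simp: PiE_iff)
  qed
  ultimately show ?thesis
    unfolding open_cover_def
    by (intro conjI ballI subset_antisym Union_least) (auto dest: openin_subset)
qed

text \<open>\<open>P\<close> stands for the conclusion of either Menger property, so that both parts
  share one construction. The second conclusion records that all sides of a chosen box come from a
  single \<open>\<V> n\<close>; this is what lets one \<open>n\<close> serve all
  coordinates.\<close>

lemma box_selection:
  fixes X :: "'a topology" and \<U> :: "nat \<Rightarrow> 'a set set"
    and P :: "nat \<Rightarrow> (nat \<Rightarrow> (nat \<Rightarrow> 'a) set set) \<Rightarrow> bool"
  assumes select: "\<And>k \<W>. \<forall>n. open_cover (finite_power X (Suc k)) (\<W> n) \<Longrightarrow>
      \<exists>\<V>. (\<forall>n. finite (\<V> n) \<and> \<V> n \<subseteq> \<W> n) \<and> P k \<V>"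
    and covers: "\<forall>n. open_cover X (\<U> n)"
  obtains \<V> where "\<forall>n. finite (\<V> n) \<and> \<V> n \<subseteq> \<U> n"
    and "\<forall>k. \<exists>\<W>. P k \<W> \<and>
      (\<forall>m. \<forall>W\<in>\<W> m. \<exists>n. \<exists>g \<in> {..<Suc k} \<rightarrow> \<V> n. W = PiE {..<Suc k} g)"
proof -
  \<comment> \<open>\<open>prod_encode\<close> gives each pair a cover of its own, so the selection
    from any one cover absorbs the boxes of only one power and one stage, and stays finite.\<close>
  define G where "G k m = ({..<Suc k} \<rightarrow>\<^sub>E \<U> (prod_encode (k, m)))" for k m
  have "\<exists>\<W>. (\<forall>m. finite (\<W> m) \<and> \<W> m \<subseteq> PiE {..<Suc k} ` G k m) \<and> P k \<W>" for k
    by (rule select) (use covers in \<open>simp add: G_def open_cover_boxes\<close>)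
  then obtain \<W> where fin: "\<And>k m. finite (\<W> k m)"
      and sub: "\<And>k m. \<W> k m \<subseteq> PiE {..<Suc k} ` G k m" and P: "\<And>k. P k (\<W> k)"
    by metis
  \<comment> \<open>A box need not determine its sides, since all boxes with an empty side coincide.
    Hence a finite set of side functions is fixed for each finite set of boxes.\<close>
  have "\<exists>C \<subseteq> G k m. finite C \<and> \<W> k m = PiE {..<Suc k} ` C" for k m
    using finite_subset_image[OF fin sub] by metis
  then obtain C where C: "\<And>k m. C k m \<subseteq> G k m" "\<And>k m. finite (C k m)"
      "\<And>k m. \<W> k m = PiE {..<Suc k} ` C k m"
    by metis
  define \<V> where "\<V> n = (case prod_decode n of (k, m) \<Rightarrow> \<Union>g\<in>C k m. g ` {..<Suc k})" for n
  have "finite (\<V> n) \<and> \<V> n \<subseteq> \<U> n" for n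
  proof (cases "prod_decode n")
    case (Pair k m)
    then have "n = prod_encode (k, m)"
      by (metis prod_decode_inverse)
    with C(1)[of k m] C(2)[of k m] show ?thesis
      by (auto simp: \<V>_def Pair G_def)
  qed
  moreover have "\<exists>n. \<exists>g \<in> {..<Suc k} \<rightarrow> \<V> n. W = PiE {..<Suc k} g" if W: "W \<in> \<W> k m" for k m W
  proof -
    obtain g where g: "g \<in> C k m" "W = PiE {..<Suc k} g"
      using W unfolding C(3) by blast
    have "g \<in> {..<Suc k} \<rightarrow> \<V> (prod_encode (k, m))"
      using g(1) unfolding \<V>_def prod_encode_inverse prod.case by blast
    with g(2) show ?thesis
      by blast
  qed
  ultimately show thesis
    by (intro that[of \<V>] exI[of _ "\<W> _"] allI conjI) (auto intro: P)
qed

text \<open>Repetitions are allowed. Nonemptiness makes the length positive, matching the exponents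
  \<open>Suc k\<close>.\<close>

lemma finite_nonempty_enumeration:
  assumes "finite A" "A \<noteq> {}"
  obtains k and f :: "nat \<Rightarrow> 'a" where "A = f ` {..<Suc k}"
proof -
  obtain n and f :: "nat \<Rightarrow> 'a" where "A = f ` {i. i < n}"
    using finite_imp_nat_seg_image_inj_on[OF assms(1)] by blast
  then have A: "A = f ` {..<n}"
    by (simp add: lessThan_def)
  with assms(2) obtain k where "n = Suc k"
    by (cases n) auto
  with A that show thesis
    by blast
qed

text \<open>The point listing \<open>F\<close> lies in the closure of a chosen box. Closure commutes
  with products, so each coordinate lies in the closure of a side, hence in that of
  \<open>\<Union>(\<V> n)\<close> for the common \<open>n\<close>.\<close>

lemma almost_Scheepers_if_powers_almost_Menger:
  assumes "\<And>k. almost_Menger (finite_power X (Suc k))"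
  shows "almost_Scheepers X"
  unfolding almost_Scheepers_def
proof (intro allI impI)
  fix \<U> :: "nat \<Rightarrow> 'a set set"
  assume covers: "\<forall>n. open_cover X (\<U> n)"
  obtain \<V> where \<V>: "\<forall>n. finite (\<V> n) \<and> \<V> n \<subseteq> \<U> n"
    and boxes: "\<forall>k. \<exists>\<W> :: nat \<Rightarrow> _. topspace (finite_power X (Suc k))
          \<subseteq> (\<Union>W\<in>(\<Union>m. \<W> m). finite_power X (Suc k) closure_of W) \<and>
        (\<forall>m. \<forall>W\<in>\<W> m. \<exists>n. \<exists>g \<in> {..<Suc k} \<rightarrow> \<V> n. W = PiE {..<Suc k} g)"
    by (rule box_selection[where P = "\<lambda>k \<W>. topspace (finite_power X (Suc k))
      \<subseteq> (\<Union>W\<in>(\<Union>m. \<W> m). finite_power X (Suc k) closure_of W)",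
      OF assms[unfolded almost_Menger_def, THEN spec, THEN mp] covers]) (assumption, rule that)
  have "\<exists>n. F \<subseteq> X closure_of \<Union>(\<V> n)" if F: "finite F" "F \<subseteq> topspace X" for F
  proof (cases "F = {}")
    case False
    then obtain k f where f: "F = f ` {..<Suc k}"
      using finite_nonempty_enumeration F(1) by metis
    \<comment> \<open>Points of the power are \<open>undefined\<close> off the index set, so the
      enumeration is cut down to it.\<close>
    define x where "x = restrict f {..<Suc k}"
    have "x \<in> topspace (finite_power X (Suc k))"
      using F(2) f by (auto simp: x_def finite_power_def)
    moreover obtain \<W> :: "nat \<Rightarrow> _" where "topspace (finite_power X (Suc k))
          \<subseteq> (\<Union>W\<in>(\<Union>m. \<W> m). finite_power X (Suc k) closure_of W)"
      and \<W>: "\<forall>m. \<forall>W\<in>\<W> m. \<exists>n. \<exists>g \<in> {..<Suc k} \<rightarrow> \<V> n. W = PiE {..<Suc k} g"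
      using boxes[THEN spec, of k] by blast
    ultimately obtain m W where W: "W \<in> \<W> m" and xW: "x \<in> finite_power X (Suc k) closure_of W"
      by blast
    obtain n g where g: "g \<in> {..<Suc k} \<rightarrow> \<V> n" "W = PiE {..<Suc k} g"
      using \<W>[rule_format, OF W] by blast
    with xW have x: "x \<in> (\<Pi>\<^sub>E i\<in>{..<Suc k}. X closure_of g i)"
      by (simp add: finite_power_def closure_of_product_topology)
    have "f i \<in> X closure_of \<Union>(\<V> n)" if i: "i \<in> {..<Suc k}" for i
    proof -
      have "f i \<in> X closure_of g i"
        using PiE_mem[OF x i] i by (simp add: x_def)
      moreover have "g i \<subseteq> \<Union>(\<V> n)"
        using g(1) i by blast
      ultimately show ?thesis
        using closure_of_mono by blast
    qed
    with f show ?thesis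
      by blast
  qed simp
  with \<V> show "\<exists>\<V>. (\<forall>n. finite (\<V> n) \<and> \<V> n \<subseteq> \<U> n) \<and>
      (\<forall>F. finite F \<and> F \<subseteq> topspace X \<longrightarrow> (\<exists>n. F \<subseteq> X closure_of \<Union>(\<V> n)))"
    by blast
qed

text \<open>The members of \<open>\<F>\<close> are the sides of a nonempty open box, which meets a
  chosen box by density. Each coordinate of a common point lies both in the given open set and in a
  side from the common \<open>\<V> n\<close>.\<close>

lemma weakly_Scheepers_if_powers_weakly_Menger:
  assumes "\<And>k. weakly_Menger (finite_power X (Suc k))"
  shows "weakly_Scheepers X"
  unfolding weakly_Scheepers_def
proof (intro allI impI)
  fix \<U> :: "nat \<Rightarrow> 'a set set"
  assume covers: "\<forall>n. open_cover X (\<U> n)"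
  obtain \<V> where \<V>: "\<forall>n. finite (\<V> n) \<and> \<V> n \<subseteq> \<U> n"
    and boxes: "\<forall>k. \<exists>\<W> :: nat \<Rightarrow> _. finite_power X (Suc k) closure_of \<Union>(\<Union>m. \<W> m)
          = topspace (finite_power X (Suc k)) \<and>
        (\<forall>m. \<forall>W\<in>\<W> m. \<exists>n. \<exists>g \<in> {..<Suc k} \<rightarrow> \<V> n. W = PiE {..<Suc k} g)"
    by (rule box_selection[where P = "\<lambda>k \<W>. finite_power X (Suc k) closure_of \<Union>(\<Union>m. \<W> m)
      = topspace (finite_power X (Suc k))",
      OF assms[unfolded weakly_Menger_def, THEN spec, THEN mp] covers]) (assumption, rule that)
  have "\<exists>n. \<forall>U\<in>\<F>. U \<inter> \<Union>(\<V> n) \<noteq> {}"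
    if \<F>: "finite \<F>" "\<forall>U\<in>\<F>. openin X U \<and> U \<noteq> {}" for \<F>
  \<comment> \<open>For empty \<open>\<F>\<close> every \<open>n\<close> works; otherwise
    \<open>\<F>\<close> gives a box in a power of positive exponent.\<close>
  proof (cases "\<F> = {}")
    case False
    then obtain k f where f: "\<F> = f ` {..<Suc k}"
      using finite_nonempty_enumeration \<F>(1) by metis
    obtain \<W> :: "nat \<Rightarrow> _" where dense: "finite_power X (Suc k) closure_of \<Union>(\<Union>m. \<W> m)
          = topspace (finite_power X (Suc k))"
      and \<W>: "\<forall>m. \<forall>W\<in>\<W> m. \<exists>n. \<exists>g \<in> {..<Suc k} \<rightarrow> \<V> n. W = PiE {..<Suc k} g"
      using boxes[THEN spec, of k] by blast
    have "openin (finite_power X (Suc k)) (PiE {..<Suc k} f)"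
      using \<F>(2) f by (auto simp: finite_power_def openin_PiE_gen)
    moreover have "PiE {..<Suc k} f \<noteq> {}"
      using \<F>(2) f by (auto simp: PiE_eq_empty_iff)
    ultimately have "\<Union>(\<Union>m. \<W> m) \<inter> PiE {..<Suc k} f \<noteq> {}"
      by (intro iffD1[OF dense_intersects_open dense, rule_format] conjI)
    then obtain x m W where x: "x \<in> PiE {..<Suc k} f" and xW: "x \<in> W" and W: "W \<in> \<W> m"
      by blast
    obtain n g where g: "g \<in> {..<Suc k} \<rightarrow> \<V> n" "W = PiE {..<Suc k} g"
      using \<W>[rule_format, OF W] by blast
    have "f i \<inter> \<Union>(\<V> n) \<noteq> {}" if i: "i \<in> {..<Suc k}" for i
      using PiE_mem[OF x i] PiE_mem[OF xW[unfolded g(2)] i] g(1) i by blast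
    with f show ?thesis
      by blast
  qed simp
  with \<V> show "\<exists>\<V>. (\<forall>n. finite (\<V> n) \<and> \<V> n \<subseteq> \<U> n) \<and>
      (\<forall>\<F>. finite \<F> \<and> (\<forall>U\<in>\<F>. openin X U \<and> U \<noteq> {}) \<longrightarrow>
        (\<exists>n. \<forall>U\<in>\<F>. U \<inter> \<Union>(\<V> n) \<noteq> {}))"
    by (intro exI[of _ \<V>] conjI allI impI) simp_all
qed

theorem theorem3p3:
  fixes X :: "'a topology"
  shows "((\<forall>k\<ge>1. almost_Menger (finite_power X k)) \<longrightarrow> almost_Scheepers X) \<and>
         ((\<forall>k\<ge>1. weakly_Menger (finite_power X k)) \<longrightarrow> weakly_Scheepers X)"
  by (simp add: almost_Scheepers_if_powers_almost_Menger weakly_Scheepers_if_powers_weakly_Menger)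

end
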